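(* For each $t\ge2$ let the maximum entropy prior $I_{\mathrm S t}$ for $t$ teams be the one with $$f_\Gamma(\gamma|I_{\mathrm S t})\propto\prod_{i=1}^{t}\prod_{j=i+1}^{t}(1+e^{-\gamma_{ij}})^{-1}(1+e^{\gamma_{ij}})^{-1}.$$ This family of priors satisfies invariance under interchange of teams, invariance under interchange of winning and losing, and normalizability, but it does not satisfy invariance under elimination of teams: already for $t=3$, the marginal density of $\gamma_{23}$ under $I_{\mathrm S3}$ differs from the density under $I_{\mathrm S2}$ of the log-odds-ratio of the two teams, $f_{\Gamma_{23}}(\gamma_{23}|I_{\mathrm S3})\neq f_{\Gamma_{23}}(\gamma_{23}|I_{\mathrm S2})$, where $$f_{\Gamma_{23}}(\gamma_{23}|I_{\mathrm S2})\propto\frac{1}{(1+e^{-\gamma_{23}})(1+e^{\gamma_{23}})}.$$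
   Context: Bradley-Terry model: $t$ teams have strengths $\pi_1,\dots,\pi_t\in(0,\infty)$ and log-strengths $\lambda_i=\ln\pi_i$; $\gamma_{ij}=\lambda_i-\lambda_j$. Let $\gamma=(\gamma_{1t},\dots,\gamma_{(t-1)t})\in\mathbb R^{t-1}$ (any other linear basis of the differences may be used, since changes of basis have constant Jacobian); every $\gamma_{ij}$ is a linear function of $\gamma$. Priors on strengths are considered up to equivalence: two priors are equivalent ($\cong$) if they induce the same density $f_\Gamma(\gamma|I)$ of $\gamma$. Thus a prior may be specified by giving $f_\Gamma$. The notation $I_{\mathrm S2}$ with $\gamma_{23}$ means the two-team prior applied to teams 2 and 3. Desiderata: 1. Invariance under interchange of teams: for any $i\ne j$, the transformation exchanging $\lambda_i$ and $\lambda_j$ and fixing all other $\lambda_k$ (and the induced linear transformation of $\gamma$) leaves $f_\Gamma$ unchanged. 2. Invariance under interchange of winning and losing: $f_\Gamma(\gamma|I)=f_\Gamma(-\gamma|I)$. 3. Normalizability: $f_\Gamma$ is a proper prior, i.e. can be normalized to $\int_{\mathbb R^{t-1}}f_\Gamma(\gamma|I)\,d^{t-1}\gamma=1$. 4. Invariance under elimination of teams (for a family of priors, one for each number of teams): for every $t>2$, the prior for $t-1$ teams is equivalent to the $t$-team prior marginalized over the strength of the team that is removed, i.e. the joint density of the log-odds-ratios among the remaining $t-1$ teams is the same under both. *)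

theory Defs
  imports "HOL-Probability.Probability"
begin

text \<open>
  Teams are numbered \<open>1, \<dots>, t\<close>.  The vector \<open>\<gamma> = (\<gamma>\<^sub>1\<^sub>t, \<dots>, \<gamma>\<^bsub>(t-1)t\<^esub>)\<close> is an element of
  \<open>{1..<t} \<rightarrow>\<^sub>E UNIV\<close>, with \<open>\<gamma> i = \<lambda>\<^sub>i - \<lambda>\<^sub>t\<close>.  A prior, up to equivalence, is given by its
  density \<open>f\<^sub>\<Gamma>\<close> with respect to Lebesgue measure on this space.
\<close>

definition gamma_space :: "nat \<Rightarrow> (nat \<Rightarrow> real) measure" where
  "gamma_space t = PiM {1..<t} (\<lambda>_. lborel)"

definition gamma_of :: "nat \<Rightarrow> (nat \<Rightarrow> real) \<Rightarrow> (nat \<Rightarrow> real)" where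
  "gamma_of t lam = (\<lambda>i\<in>{1..<t}. lam i - lam t)"

text \<open>
  Log-strengths inducing a given \<open>\<gamma>\<close>, fixed by the choice \<open>\<lambda>\<^sub>t = 0\<close>; differences of
  log-strengths do not depend on this choice.
\<close>

definition lam_of :: "nat \<Rightarrow> (nat \<Rightarrow> real) \<Rightarrow> (nat \<Rightarrow> real)" where
  "lam_of t \<gamma> = \<gamma>(t := 0)"

definition log_odds :: "nat \<Rightarrow> (nat \<Rightarrow> real) \<Rightarrow> nat \<Rightarrow> nat \<Rightarrow> real" where
  "log_odds t \<gamma> i j = lam_of t \<gamma> i - lam_of t \<gamma> j"

definition prior_measure :: "nat \<Rightarrow> ((nat \<Rightarrow> real) \<Rightarrow> real) \<Rightarrow> (nat \<Rightarrow> real) measure" where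
  "prior_measure t f = density (gamma_space t) (\<lambda>\<gamma>. ennreal (f \<gamma>))"

definition proportional :: "('a \<Rightarrow> real) \<Rightarrow> ('a \<Rightarrow> real) \<Rightarrow> bool" where
  "proportional f g \<longleftrightarrow> (\<exists>c>0. \<forall>x. f x = c * g x)"


text \<open>
  Interchanging two teams acts on \<open>\<gamma>\<close> by a linear involution, whose Jacobian has absolute
  value 1, so that no Jacobian factor appears here.  Every \<open>\<gamma>\<close> is of the form
  \<open>gamma_of t lam\<close>.
\<close>

definition team_interchange_invariant :: "nat \<Rightarrow> ((nat \<Rightarrow> real) \<Rightarrow> real) \<Rightarrow> bool" where
  "team_interchange_invariant t f \<longleftrightarrow>
     (\<forall>i\<in>{1..t}. \<forall>j\<in>{1..t}. i \<noteq> j \<longrightarrow>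
        (\<forall>lam. f (gamma_of t (lam(i := lam j, j := lam i))) = f (gamma_of t lam)))"

definition win_loss_invariant :: "nat \<Rightarrow> ((nat \<Rightarrow> real) \<Rightarrow> real) \<Rightarrow> bool" where
  "win_loss_invariant t f \<longleftrightarrow>
     (\<forall>\<gamma>\<in>space (gamma_space t). f (\<lambda>i\<in>{1..<t}. - \<gamma> i) = f \<gamma>)"

definition normalizable :: "nat \<Rightarrow> ((nat \<Rightarrow> real) \<Rightarrow> real) \<Rightarrow> bool" where
  "normalizable t f \<longleftrightarrow>
     (\<forall>\<gamma>\<in>space (gamma_space t). 0 \<le> f \<gamma>) \<and>
     (\<exists>c>0. has_bochner_integral (gamma_space t) (\<lambda>\<gamma>. c * f \<gamma>) 1)"

text \<open>
  When team \<open>k\<close> is removed, the remaining teams are renumbered \<open>1, \<dots>, t - 1\<close> in their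
  original order: the new team \<open>i\<close> is the old team \<open>skip_team k i\<close>.
\<close>

definition skip_team :: "nat \<Rightarrow> nat \<Rightarrow> nat" where
  "skip_team k i = (if i < k then i else Suc i)"

definition eliminate :: "nat \<Rightarrow> nat \<Rightarrow> (nat \<Rightarrow> real) \<Rightarrow> (nat \<Rightarrow> real)" where
  "eliminate t k \<gamma> = gamma_of (t - 1) (lam_of t \<gamma> \<circ> skip_team k)"

definition elimination_invariant :: "(nat \<Rightarrow> (nat \<Rightarrow> real) \<Rightarrow> real) \<Rightarrow> bool" where
  "elimination_invariant F \<longleftrightarrow>
     (\<forall>t>2. \<forall>k\<in>{1..t}.
        distributed (prior_measure t (F t)) (gamma_space (t - 1)) (eliminate t k)
          (\<lambda>\<gamma>. ennreal (F (t - 1) \<gamma>)))"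


definition max_ent_kernel :: "nat \<Rightarrow> (nat \<Rightarrow> real) \<Rightarrow> real" where
  "max_ent_kernel t \<gamma> =
     (\<Prod>i=1..t. \<Prod>j=i+1..t.
        inverse (1 + exp (- log_odds t \<gamma> i j)) * inverse (1 + exp (log_odds t \<gamma> i j)))"

definition max_ent_prior :: "nat \<Rightarrow> (nat \<Rightarrow> real) \<Rightarrow> real" where
  "max_ent_prior t \<gamma> = max_ent_kernel t \<gamma> / (\<integral>\<gamma>'. max_ent_kernel t \<gamma>' \<partial>gamma_space t)"

text \<open>
  Densities of \<open>\<gamma>\<^sub>2\<^sub>3\<close>: the three-team prior with \<open>\<gamma>\<^sub>1\<^sub>3\<close> integrated out, and the two-team prior
  with its teams 1 and 2 in the roles of teams 2 and 3.
\<close>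

definition density23_S3 :: "real \<Rightarrow> real" where
  "density23_S3 x = (\<integral>y. max_ent_prior 3 (\<lambda>i\<in>{1..<3}. if i = 1 then y else x) \<partial>lborel)"

definition density23_S2 :: "real \<Rightarrow> real" where
  "density23_S2 x = max_ent_prior 2 (\<lambda>i\<in>{1..<2}. x)"

end

theory Submission
  imports Defs
begin

text \<open>
  The kernel is a product of values \<open>s(\<lambda>\<^sub>i - \<lambda>\<^sub>j)\<close> of the logistic density \<open>s\<close>, which is positive, even,
  integrable and at most \<open>1\<close>.  Evenness gives both symmetries.  Keeping only the factors with
  \<open>j = t\<close> dominates the kernel by \<open>\<Prod>\<^sub>i s(\<gamma>\<^sub>i)\<close>, hence normalizability.  For three teams the density
  of \<open>\<gamma>\<^sub>2\<^sub>3\<close> is proportional to \<open>s(x) (s \<star> s)(x)\<close>; it would agree with the two-team density only if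
  the autocorrelation \<open>s \<star> s\<close> were a positive constant, which is impossible since
  \<open>s \<star> s\<close> is integrable.
\<close>

section \<open>The logistic density\<close>

definition logistic_density :: "real \<Rightarrow> real" where
  "logistic_density x = inverse (1 + exp (- x)) * inverse (1 + exp x)"

lemma logistic_density_pos: "0 < logistic_density x"
  by (simp add: logistic_density_def add_pos_pos)

lemma logistic_density_le_1: "logistic_density x \<le> 1"
proof -
  have "inverse (1 + exp (- x)) \<le> 1" "inverse (1 + exp x) \<le> 1"
    by (auto intro!: inverse_le_1_iff[THEN iffD2] simp: add_pos_pos)
  then show ?thesis
    unfolding logistic_density_def by (intro mult_le_one) (auto simp: add_pos_pos less_imp_le)
qed

lemma logistic_density_minus: "logistic_density (- x) = logistic_density x"
  by (simp add: logistic_density_def)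

lemma logistic_density_measurable [measurable]: "logistic_density \<in> borel_measurable borel"
  unfolding logistic_density_def[abs_def] by measurable

text \<open>Comparison with a multiple of the Cauchy density: expanding the two factors gives the
  denominator \<open>2 + exp x + exp (- x)\<close>, which grows at least quadratically.\<close>

lemma integrable_logistic_density: "integrable lborel logistic_density"
proof (rule Bochner_Integration.integrable_bound)
  show "integrable lborel (\<lambda>x::real. 2 * inverse (1 + x\<^sup>2))"
    using integrable_inverse_1_plus_square by (simp add: set_integrable_def)
  show "AE x in lborel. norm (logistic_density x) \<le> norm (2 * inverse (1 + x\<^sup>2))"
  proof (rule AE_I2)
    fix x :: real
    \<comment> \<open>Quadratic Taylor bound for whichever exponential has a nonnegative argument;
      the other exponential is only used as nonnegative.\<close>
    have le: "1 + x\<^sup>2 / 2 \<le> exp x + exp (- x)"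
    proof (cases "0 \<le> x")
      case True
      then have "1 + x + x\<^sup>2 / 2 \<le> exp x"
        by (rule exp_lower_Taylor_quadratic)
      then show ?thesis using True exp_ge_zero[of "-x"] by linarith
    next
      case False
      then have "1 - x + x\<^sup>2 / 2 \<le> exp (- x)"
        using exp_lower_Taylor_quadratic[of "- x"] by simp
      then show ?thesis using False exp_ge_zero[of x] by linarith
    qed
    have "(1 + exp (- x)) * (1 + exp x) = 2 + exp x + exp (- x)"
      by (simp add: algebra_simps flip: exp_add)
    then have "logistic_density x = inverse (2 + exp x + exp (- x))"
      by (simp add: logistic_density_def flip: inverse_mult_distrib)
    also have "\<dots> \<le> inverse ((1 + x\<^sup>2) / 2)"
      using le by (intro le_imp_inverse_le) (auto simp: add_pos_nonneg)
    finally show "norm (logistic_density x) \<le> norm (2 * inverse (1 + x\<^sup>2))"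
      using logistic_density_pos[of x] by (simp add: field_simps)
  qed
qed simp

section \<open>The kernel, its integral and normalizability\<close>

lemma max_ent_kernel_eq:
  "max_ent_kernel t \<gamma> = (\<Prod>(i, j)\<in>(SIGMA i:{1..t}. {i+1..t}). logistic_density (log_odds t \<gamma> i j))"
  unfolding max_ent_kernel_def logistic_density_def by (subst prod.Sigma) auto

lemma max_ent_kernel_pos: "0 < max_ent_kernel t \<gamma>"
  unfolding max_ent_kernel_eq by (intro prod_pos) (auto simp: logistic_density_pos)

text \<open>Since \<open>lam_of\<close> puts team \<open>t\<close> at 0, each pair
  \<open>(i, t)\<close> contributes exactly \<open>logistic_density (\<gamma> i)\<close>. All other
  factors are at most 1. The bound splits into one-variable factors, so it can be integrated
  coordinatewise.\<close>

lemma max_ent_kernel_le: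
  "max_ent_kernel t \<gamma> \<le> (\<Prod>i\<in>{1..<t}. logistic_density (\<gamma> i))"
proof -
  let ?P = "SIGMA i:{1..t}. {i+1..t}" and ?s = "\<lambda>(i, j). logistic_density (log_odds t \<gamma> i j)"
  let ?Q = "(\<lambda>i. (i, t)) ` {1..<t}"
  have Q: "?Q \<subseteq> ?P" "finite ?P" by auto
  have "max_ent_kernel t \<gamma> = prod ?s (?P - ?Q) * prod ?s ?Q"
    unfolding max_ent_kernel_eq using prod.subset_diff[OF Q, of ?s] by simp
  also have "\<dots> \<le> 1 * prod ?s ?Q"
    by (intro mult_right_mono prod_le_1 prod_nonneg)
       (auto simp: logistic_density_le_1 logistic_density_pos less_imp_le)
  also have "prod ?s ?Q = (\<Prod>i\<in>{1..<t}. logistic_density (\<gamma> i))"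
    by (subst prod.reindex) (auto simp: inj_on_def log_odds_def lam_of_def intro!: prod.cong)
  finally show ?thesis by simp
qed

lemma lam_of_measurable [measurable]:
  assumes "i \<in> {1..t}"
  shows "(\<lambda>\<gamma>. lam_of t \<gamma> i) \<in> borel_measurable (gamma_space t)"
proof (cases "i = t")
  case False
  with assms show ?thesis
    unfolding lam_of_def gamma_space_def by simp
qed (simp add: lam_of_def)

lemma log_odds_measurable:
  "i \<in> {1..t} \<Longrightarrow> j \<in> {1..t} \<Longrightarrow> (\<lambda>\<gamma>. log_odds t \<gamma> i j) \<in> borel_measurable (gamma_space t)"
  unfolding log_odds_def by (intro borel_measurable_diff lam_of_measurable)

lemma max_ent_kernel_measurable [measurable]:
  "max_ent_kernel t \<in> borel_measurable (gamma_space t)"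
proof -
  have "(\<lambda>\<gamma>. logistic_density (log_odds t \<gamma> i j)) \<in> borel_measurable (gamma_space t)"
    if "i \<in> {1..t}" "j \<in> {1..t}" for i j
    by (rule measurable_compose[OF log_odds_measurable[OF that] logistic_density_measurable])
  then show ?thesis
    unfolding max_ent_kernel_eq[abs_def] by (intro borel_measurable_prod) auto
qed

interpretation lborel_product: product_sigma_finite "\<lambda>_ :: nat. lborel :: real measure"
  by standard

lemma integrable_max_ent_kernel: "integrable (gamma_space t) (max_ent_kernel t)"
proof (rule Bochner_Integration.integrable_bound)
  show "integrable (gamma_space t) (\<lambda>\<gamma>. \<Prod>i\<in>{1..<t}. logistic_density (\<gamma> i))"
    unfolding gamma_space_def
    by (intro lborel_product.product_integrable_prod integrable_logistic_density) auto
  show "AE \<gamma> in gamma_space t. norm (max_ent_kernel t \<gamma>) \<le> norm (\<Prod>i\<in>{1..<t}. logistic_density (\<gamma> i))"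
    using max_ent_kernel_le max_ent_kernel_pos
    by (intro AE_I2) (smt (verit) real_norm_def)
qed simp

text \<open>The measure of the whole space is a product of infinite factors (empty product 1 if
  there are no coordinates). Hence \<open>False\<close> cannot hold almost everywhere, which makes
  the integral of a positive function strictly positive.\<close>

lemma emeasure_gamma_space: "emeasure (gamma_space t) (space (gamma_space t)) \<noteq> 0"
  unfolding gamma_space_def space_PiM by (subst lborel_product.emeasure_PiM) auto

lemma integral_max_ent_kernel_pos: "0 < (\<integral>\<gamma>. max_ent_kernel t \<gamma> \<partial>gamma_space t)"
proof -
  have "(\<integral>\<gamma>. max_ent_kernel t \<gamma> \<partial>gamma_space t) \<noteq> 0"
  proof
    assume "(\<integral>\<gamma>. max_ent_kernel t \<gamma> \<partial>gamma_space t) = 0"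
    then have "AE \<gamma> in gamma_space t. max_ent_kernel t \<gamma> = 0"
      by (subst (asm) integral_nonneg_eq_0_iff_AE)
         (auto simp: integrable_max_ent_kernel max_ent_kernel_pos less_imp_le)
    then have "AE \<gamma> in gamma_space t. False"
      using max_ent_kernel_pos by (auto simp: less_le)
    then show False
      using emeasure_gamma_space[of t] by (simp add: AE_iff_measurable[OF sets.top])
  qed
  moreover have "0 \<le> (\<integral>\<gamma>. max_ent_kernel t \<gamma> \<partial>gamma_space t)"
    by (intro integral_nonneg_AE AE_I2 less_imp_le max_ent_kernel_pos)
  ultimately show ?thesis by simp
qed

lemma max_ent_prior_measurable [measurable]:
  "max_ent_prior t \<in> borel_measurable (gamma_space t)"
  unfolding max_ent_prior_def[abs_def] by measurable

lemma max_ent_prior_pos: "0 < max_ent_prior t \<gamma>"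
  by (simp add: max_ent_prior_def max_ent_kernel_pos integral_max_ent_kernel_pos)

lemma proportional_max_ent_prior: "proportional (max_ent_prior t) (max_ent_kernel t)"
  unfolding proportional_def max_ent_prior_def
  by (intro exI[of _ "inverse (\<integral>\<gamma>. max_ent_kernel t \<gamma> \<partial>gamma_space t)"])
     (simp add: integral_max_ent_kernel_pos field_simps)

lemma normalizable_max_ent_prior: "normalizable t (max_ent_prior t)"
  unfolding normalizable_def
\<comment> \<open>The witness is 1 because \<open>max_ent_prior\<close> is already divided by its
  normalizing integral.\<close>
proof (intro conjI exI[of _ "1::real"] ballI less_imp_le max_ent_prior_pos)
  show "has_bochner_integral (gamma_space t) (\<lambda>\<gamma>. 1 * max_ent_prior t \<gamma>) 1"
    using integral_max_ent_kernel_pos[of t] integrable_max_ent_kernel[of t]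
    by (simp add: max_ent_prior_def[abs_def] has_bochner_integral_iff)
qed simp

section \<open>Interchange of teams and of winning and losing\<close>

lemma log_odds_gamma_of:
  "i \<in> {1..t} \<Longrightarrow> j \<in> {1..t} \<Longrightarrow> log_odds t (gamma_of t lam) i j = lam i - lam j"
  by (auto simp: log_odds_def lam_of_def gamma_of_def)

text \<open>Expressing the kernel through arbitrary log-strengths removes the special role of team
  \<open>t\<close>, so interchanges involving \<open>t\<close> need no separate treatment.\<close>

lemma max_ent_kernel_gamma_of:
  "max_ent_kernel t (gamma_of t lam) =
     (\<Prod>(i, j)\<in>(SIGMA i:{1..t}. {i+1..t}). logistic_density (lam i - lam j))"
  unfolding max_ent_kernel_eq by (intro prod.cong) (auto simp: log_odds_gamma_of)

text \<open>Pairs with \<open>i < j\<close> represent unordered pairs of teams, and a transposition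
  permutes these. An image pair may come out in reverse order, which the symmetry of
  \<open>g\<close> absorbs.\<close>

lemma prod_pairs_transpose:
  fixes g :: "nat \<Rightarrow> nat \<Rightarrow> 'a::comm_monoid_mult"
  assumes sym: "\<And>i j. g i j = g j i" and ab: "a \<in> {1..t}" "b \<in> {1..t}"
  shows "(\<Prod>(i, j)\<in>(SIGMA i:{1..t}. {i+1..t}). g (Transposition.transpose a b i) (Transposition.transpose a b j)) =
         (\<Prod>(i, j)\<in>(SIGMA i:{1..t}. {i+1..t}). g i j)"
proof -
  let ?\<sigma> = "Transposition.transpose a b"
  \<comment> \<open>Apply the transposition, then sort; this map is its own inverse and serves as
    both directions of the reindexing.\<close>
  let ?p = "\<lambda>(i, j). (min (?\<sigma> i) (?\<sigma> j), max (?\<sigma> i) (?\<sigma> j))"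
  have mem: "?\<sigma> i \<in> {1..t}" if "i \<in> {1..t}" for i
    using ab that by (auto simp: Transposition.transpose_def)
  have ne: "?\<sigma> i \<noteq> ?\<sigma> j" if "i \<noteq> j" for i j
    using that by (metis Transposition.transpose_involutory)
  have pP: "?p x \<in> (SIGMA i:{1..t}. {i+1..t})" if "x \<in> (SIGMA i:{1..t}. {i+1..t})" for x
  proof -
    obtain i j where x: "x = (i, j)" by (cases x)
    with that have ij: "i \<in> {1..t}" "j \<in> {1..t}" "i < j" by auto
    show ?thesis
      using mem[OF ij(1)] mem[OF ij(2)] ne[of i j] ij(3) x by (auto simp: min_def max_def)
  qed
  have pp: "?p (?p x) = x" if "x \<in> (SIGMA i:{1..t}. {i+1..t})" for x
    using that by (auto simp: min_def max_def)
  show ?thesis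
  proof (rule prod.reindex_bij_witness[where i = ?p and j = ?p])
    fix x assume "x \<in> (SIGMA i:{1..t}. {i+1..t})"
    show "(case ?p x of (i, j) \<Rightarrow> g i j) = (case x of (i, j) \<Rightarrow> g (?\<sigma> i) (?\<sigma> j))"
      using sym by (auto simp: min_def max_def split: prod.split)
  qed (fact pp pP)+
qed

lemma team_interchange_invariant_max_ent_prior:
  "team_interchange_invariant t (max_ent_prior t)"
  unfolding team_interchange_invariant_def
proof (intro ballI impI allI)
  fix a b and lam :: "nat \<Rightarrow> real"
  assume ab: "a \<in> {1..t}" "b \<in> {1..t}" "a \<noteq> b"
  have lam: "(lam(a := lam b, b := lam a)) i = lam (Transposition.transpose a b i)" for i
    using ab(3) by (simp add: Transposition.transpose_def)
  have "max_ent_kernel t (gamma_of t (lam(a := lam b, b := lam a))) = max_ent_kernel t (gamma_of t lam)"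
    unfolding max_ent_kernel_gamma_of lam
    by (rule prod_pairs_transpose[where g = "\<lambda>i j. logistic_density (lam i - lam j)", OF _ ab(1,2)])
       (metis logistic_density_minus minus_diff_eq)
  then show "max_ent_prior t (gamma_of t (lam(a := lam b, b := lam a))) = max_ent_prior t (gamma_of t lam)"
    by (simp add: max_ent_prior_def)
qed

text \<open>Negating \<gamma> negates every log-odds-ratio, including those with team
  \<open>t\<close>, whose coordinate stays 0; \<open>logistic_density\<close> is even.\<close>

lemma win_loss_invariant_max_ent_prior: "win_loss_invariant t (max_ent_prior t)"
  unfolding win_loss_invariant_def
proof
  fix \<gamma> :: "nat \<Rightarrow> real"
  have "log_odds t (\<lambda>i\<in>{1..<t}. - \<gamma> i) i j = - log_odds t \<gamma> i j"
    if "i \<in> {1..t}" "j \<in> {1..t}" for i j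
    using that by (auto simp: log_odds_def lam_of_def)
  then have "max_ent_kernel t (\<lambda>i\<in>{1..<t}. - \<gamma> i) = max_ent_kernel t \<gamma>"
    unfolding max_ent_kernel_eq by (intro prod.cong) (auto simp: logistic_density_minus)
  then show "max_ent_prior t (\<lambda>i\<in>{1..<t}. - \<gamma> i) = max_ent_prior t \<gamma>"
    by (simp add: max_ent_prior_def)
qed

section \<open>Two and three teams, and the autocorrelation\<close>

lemma max_ent_kernel_2: "max_ent_kernel 2 \<gamma> = logistic_density (\<gamma> 1)"
proof -
  have "{1..2::nat} = {1, 2}" by auto
  then show ?thesis
    by (simp add: max_ent_kernel_def logistic_density_def log_odds_def lam_of_def)
qed

lemma max_ent_kernel_3:
  "max_ent_kernel 3 \<gamma> = logistic_density (\<gamma> 1 - \<gamma> 2) * logistic_density (\<gamma> 1) * logistic_density (\<gamma> 2)"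
proof -
  have "{1..3::nat} = {1, 2, 3}" "{Suc (Suc 0)..3} = {2, 3}" by auto
  then show ?thesis
    by (simp add: max_ent_kernel_def logistic_density_def log_odds_def lam_of_def)
qed

text \<open>With \<open>y\<close> as the log-odds of team 1 against 3 and \<open>x\<close> of team 2
  against 3, this integrates out the two kernel factors that involve team 1. By evenness it is also
  the convolution of the logistic density with itself.\<close>

definition logistic_autocorrelation :: "real \<Rightarrow> real" where
  "logistic_autocorrelation x = (\<integral>y. logistic_density (y - x) * logistic_density y \<partial>lborel)"

text \<open>Holds for every \<open>x\<close>, so the Bochner integral defining
  \<open>logistic_autocorrelation\<close> never takes its default value 0 and agrees with the
  nonnegative integral.\<close>

lemma integrable_logistic_autocorrelation:
  "integrable lborel (\<lambda>y. logistic_density (y - x) * logistic_density y)"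
proof (rule Bochner_Integration.integrable_bound[OF integrable_logistic_density])
  show "AE y in lborel. norm (logistic_density (y - x) * logistic_density y) \<le> norm (logistic_density y)"
    using logistic_density_le_1 logistic_density_pos
    by (intro AE_I2) (simp add: abs_mult mult_left_le_one_le less_imp_le)
qed simp

lemma logistic_autocorrelation_measurable [measurable]:
  "logistic_autocorrelation \<in> borel_measurable borel"
  unfolding logistic_autocorrelation_def[abs_def] by measurable

lemma logistic_autocorrelation_nonneg: "0 \<le> logistic_autocorrelation x"
  unfolding logistic_autocorrelation_def
  by (intro integral_nonneg_AE AE_I2 mult_nonneg_nonneg less_imp_le logistic_density_pos)

lemma ennreal_logistic_autocorrelation:
  "ennreal (logistic_autocorrelation x) =
     (\<integral>\<^sup>+y. ennreal (logistic_density (y - x) * logistic_density y) \<partial>lborel)"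
  unfolding logistic_autocorrelation_def
  by (intro nn_integral_eq_integral[symmetric] integrable_logistic_autocorrelation AE_I2
        mult_nonneg_nonneg less_imp_le logistic_density_pos)

lemma nn_integral_logistic_density_finite: "(\<integral>\<^sup>+y. ennreal (logistic_density y) \<partial>lborel) < \<infinity>"
  using integrable_logistic_density
  by (subst nn_integral_eq_integral) (auto simp: logistic_density_pos less_imp_le)

text \<open>By Tonelli, integrating over \<open>x\<close> first gives the square of the finite
  integral of \<open>logistic_density\<close>.\<close>

lemma nn_integral_logistic_autocorrelation_finite:
  "(\<integral>\<^sup>+x. ennreal (logistic_autocorrelation x) \<partial>lborel) < \<infinity>"
proof -
  let ?I = "\<integral>\<^sup>+y. ennreal (logistic_density y) \<partial>lborel"
  \<comment> \<open>The substitution sending \<open>x\<close> to \<open>y - x\<close> has slope -1,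
    hence scaling factor 1.\<close>
  have shift: "(\<integral>\<^sup>+x. ennreal (logistic_density (y - x)) \<partial>lborel) = ?I" for y
    using nn_integral_real_affine[of "\<lambda>x. ennreal (logistic_density x)" "-1" y] by simp
  have "(\<integral>\<^sup>+x. ennreal (logistic_autocorrelation x) \<partial>lborel) =
      (\<integral>\<^sup>+x. \<integral>\<^sup>+y. ennreal (logistic_density (y - x)) * ennreal (logistic_density y) \<partial>lborel \<partial>lborel)"
    unfolding ennreal_logistic_autocorrelation
    by (simp add: ennreal_mult logistic_density_pos less_imp_le)
  also have "\<dots> = (\<integral>\<^sup>+y. \<integral>\<^sup>+x. ennreal (logistic_density (y - x)) * ennreal (logistic_density y) \<partial>lborel \<partial>lborel)"
    by (intro lborel_pair.Fubini') measurable
  also have "\<dots> = ?I * ?I"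
    by (simp add: nn_integral_multc shift nn_integral_cmult)
  finally show ?thesis
    using nn_integral_logistic_density_finite by (simp add: ennreal_mult_less_top)
qed

section \<open>Comparison of the two densities\<close>

lemma density23_S2_eq:
  "density23_S2 x = logistic_density x / (\<integral>\<gamma>. max_ent_kernel 2 \<gamma> \<partial>gamma_space 2)"
  by (simp add: density23_S2_def max_ent_prior_def max_ent_kernel_2)

lemma density23_S3_eq:
  "density23_S3 x =
     logistic_density x * logistic_autocorrelation x / (\<integral>\<gamma>. max_ent_kernel 3 \<gamma> \<partial>gamma_space 3)"
  by (simp add: density23_S3_def max_ent_prior_def max_ent_kernel_3 logistic_autocorrelation_def)

lemma density23_S2_measurable [measurable]: "density23_S2 \<in> borel_measurable borel"
  unfolding density23_S2_eq[abs_def] by measurable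

lemma density23_S3_measurable [measurable]: "density23_S3 \<in> borel_measurable borel"
  unfolding density23_S3_eq[abs_def] by measurable

lemma density23_S2_nonneg: "0 \<le> density23_S2 x"
  by (simp add: density23_S2_def max_ent_prior_pos less_imp_le)

lemma density23_S3_nonneg: "0 \<le> density23_S3 x"
  unfolding density23_S3_def by (intro integral_nonneg_AE AE_I2 less_imp_le max_ent_prior_pos)

text \<open>Cancelling the positive factor \<open>logistic_density x\<close> turns equality of the
  densities into constancy of the autocorrelation. A positive constant has infinite integral over
  the line.\<close>

lemma density23_S3_not_AE_eq_density23_S2: "\<not> (AE x in lborel. density23_S3 x = density23_S2 x)"
proof
  \<comment> \<open>The ratio of normalizing constants is the value the autocorrelation would have
    to take.\<close>
  define c where "c = (\<integral>\<gamma>. max_ent_kernel 3 \<gamma> \<partial>gamma_space 3) / (\<integral>\<gamma>. max_ent_kernel 2 \<gamma> \<partial>gamma_space 2)"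
  have c: "c > 0"
    by (simp add: c_def integral_max_ent_kernel_pos)
  assume "AE x in lborel. density23_S3 x = density23_S2 x"
  then have "AE x in lborel. ennreal (logistic_autocorrelation x) = ennreal c"
  proof eventually_elim
    case (elim x)
    then have "logistic_autocorrelation x = c"
      using logistic_density_pos[of x] integral_max_ent_kernel_pos[of 2] integral_max_ent_kernel_pos[of 3]
      by (simp add: density23_S2_eq density23_S3_eq c_def field_simps)
    then show ?case by simp
  qed
  then have "(\<integral>\<^sup>+x. ennreal (logistic_autocorrelation x) \<partial>lborel) = (\<integral>\<^sup>+(x::real). ennreal c \<partial>lborel)"
    by (rule nn_integral_cong_AE)
  also have "\<dots> = \<infinity>"
    using c by (simp add: ennreal_mult_top)
  finally show False
    using nn_integral_logistic_autocorrelation_finite by simp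
qed

section \<open>Laws of the log-odds-ratio and failure of elimination\<close>

text \<open>Reduces a claim about the law of \<open>X\<close> to an identity of nonnegative
  integrals over Borel sets, where the integration rules for products apply.\<close>

lemma distributed_prior_measureI:
  assumes [measurable]: "X \<in> borel_measurable (gamma_space t)" "f \<in> borel_measurable (gamma_space t)"
    "g \<in> borel_measurable borel"
  assumes eq: "\<And>A. A \<in> sets borel \<Longrightarrow>
    (\<integral>\<^sup>+\<gamma>. ennreal (f \<gamma>) * indicator A (X \<gamma>) \<partial>gamma_space t) = (\<integral>\<^sup>+x. g x * indicator A x \<partial>lborel)"
  shows "distributed (prior_measure t f) lborel X g"
  unfolding distributed_def
proof (intro conjI)
  show "distr (prior_measure t f) lborel X = density lborel g"
  proof (rule measure_eqI)
    fix A assume "A \<in> sets (distr (prior_measure t f) lborel X)"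
    then have A[measurable]: "A \<in> sets borel" by simp
    have "emeasure (distr (prior_measure t f) lborel X) A =
        emeasure (density (gamma_space t) (\<lambda>\<gamma>. ennreal (f \<gamma>))) (X -` A \<inter> space (gamma_space t))"
      by (subst emeasure_distr) (auto simp: prior_measure_def)
    also have "\<dots> = (\<integral>\<^sup>+\<gamma>. ennreal (f \<gamma>) * indicator (X -` A \<inter> space (gamma_space t)) \<gamma> \<partial>gamma_space t)"
      by (rule emeasure_density) measurable
    also have "\<dots> = (\<integral>\<^sup>+\<gamma>. ennreal (f \<gamma>) * indicator A (X \<gamma>) \<partial>gamma_space t)"
      by (intro nn_integral_cong) (auto simp: indicator_def)
    also have "\<dots> = emeasure (density lborel g) A"
      by (simp add: eq A emeasure_density)
    finally show "emeasure (distr (prior_measure t f) lborel X) A = emeasure (density lborel g) A" .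
  qed simp
qed (simp_all add: prior_measure_def)

lemma distributed_log_odds_2:
  "distributed (prior_measure 2 (max_ent_prior 2)) lborel (\<lambda>\<gamma>. log_odds 2 \<gamma> 1 2)
     (\<lambda>x. ennreal (density23_S2 x))"
proof (rule distributed_prior_measureI)
  fix A :: "real set" assume [measurable]: "A \<in> sets borel"
  have prior: "max_ent_prior 2 \<gamma> = density23_S2 (\<gamma> 1)" for \<gamma>
    by (simp add: density23_S2_eq max_ent_prior_def max_ent_kernel_2)
  have "{1..<2::nat} = {1}" by auto
  then show "(\<integral>\<^sup>+\<gamma>. ennreal (max_ent_prior 2 \<gamma>) * indicator A (log_odds 2 \<gamma> 1 2) \<partial>gamma_space 2) =
      (\<integral>\<^sup>+x. ennreal (density23_S2 x) * indicator A x \<partial>lborel)"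
    using lborel_product.product_nn_integral_singleton
      [of "\<lambda>x. ennreal (density23_S2 x) * indicator A x" 1]
    by (simp add: gamma_space_def prior log_odds_def lam_of_def)
qed (auto intro!: log_odds_measurable)

lemma distributed_log_odds_3:
  "distributed (prior_measure 3 (max_ent_prior 3)) lborel (\<lambda>\<gamma>. log_odds 3 \<gamma> 2 3)
     (\<lambda>x. ennreal (density23_S3 x))"
proof (rule distributed_prior_measureI)
  fix A :: "real set" assume [measurable]: "A \<in> sets borel"
  define Z where "Z = (\<integral>\<gamma>. max_ent_kernel 3 \<gamma> \<partial>gamma_space 3)"
  \<comment> \<open>The joint density, grouped so that the factor free of \<open>y\<close> can be
    pulled out of the integral over \<open>y\<close>.\<close>
  define p where "p y x = logistic_density (y - x) * logistic_density y * (logistic_density x / Z)" for y x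
  have Z: "Z > 0" by (simp add: Z_def integral_max_ent_kernel_pos)
  have [measurable]: "case_prod p \<in> borel_measurable (borel \<Otimes>\<^sub>M borel)"
    unfolding p_def[abs_def] by measurable
  have prior: "max_ent_prior 3 \<gamma> = p (\<gamma> 1) (\<gamma> 2)" for \<gamma>
    by (simp add: p_def Z_def max_ent_prior_def max_ent_kernel_3)
  have marginal: "(\<integral>\<^sup>+y. ennreal (p y x) \<partial>lborel) = ennreal (density23_S3 x)" for x
  proof -
    have "(\<integral>\<^sup>+y. ennreal (p y x) \<partial>lborel) =
        (\<integral>\<^sup>+y. ennreal (logistic_density (y - x) * logistic_density y) * ennreal (logistic_density x / Z) \<partial>lborel)"
      unfolding p_def using Z logistic_density_pos
      by (intro nn_integral_cong ennreal_mult) (auto intro!: less_imp_le)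
    also have "\<dots> = ennreal (logistic_autocorrelation x) * ennreal (logistic_density x / Z)"
      by (simp add: nn_integral_multc ennreal_logistic_autocorrelation)
    also have "\<dots> = ennreal (density23_S3 x)"
      using Z logistic_density_pos[of x] logistic_autocorrelation_nonneg[of x]
      by (simp add: density23_S3_eq Z_def mult.commute flip: ennreal_mult)
    finally show ?thesis .
  qed
  have "{1..<3::nat} = {1, 2}" by auto
  then have "(\<integral>\<^sup>+\<gamma>. ennreal (max_ent_prior 3 \<gamma>) * indicator A (log_odds 3 \<gamma> 2 3) \<partial>gamma_space 3) =
      (\<integral>\<^sup>+\<gamma>. ennreal (p (\<gamma> 1) (\<gamma> 2)) * indicator A (\<gamma> 2) \<partial>PiM {1, 2::nat} (\<lambda>_. lborel))"
    by (simp add: gamma_space_def prior log_odds_def lam_of_def)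
  \<comment> \<open>The product over the index set \<open>{1, 2}\<close> is identified with a binary
    product, so that Tonelli can integrate out the first coordinate.\<close>
  also have "\<dots> = (\<integral>\<^sup>+z. ennreal (p (fst z) (snd z)) * indicator A (snd z) \<partial>(lborel \<Otimes>\<^sub>M lborel))"
    by (intro lborel_product.product_nn_integral_pair[where f = "\<lambda>y x. ennreal (p y x) * indicator A x"]) auto
  also have "\<dots> = (\<integral>\<^sup>+x. \<integral>\<^sup>+y. ennreal (p y x) * indicator A x \<partial>lborel \<partial>lborel)"
    by (subst lborel_pair.nn_integral_snd[symmetric]) auto
  also have "\<dots> = (\<integral>\<^sup>+x. ennreal (density23_S3 x) * indicator A x \<partial>lborel)"
    by (simp add: nn_integral_multc marginal)
  finally show "(\<integral>\<^sup>+\<gamma>. ennreal (max_ent_prior 3 \<gamma>) * indicator A (log_odds 3 \<gamma> 2 3) \<partial>gamma_space 3) =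
      (\<integral>\<^sup>+x. ennreal (density23_S3 x) * indicator A x \<partial>lborel)" .
qed (auto intro!: log_odds_measurable)

text \<open>Removing team 1 of three would force the same law of the log-odds-ratio under both
  priors, hence densities equal almost everywhere.\<close>

lemma not_elimination_invariant_max_ent_prior: "\<not> elimination_invariant max_ent_prior"
proof
  let ?M = "prior_measure 3 (max_ent_prior 3)"
  assume "elimination_invariant max_ent_prior"
  then have D: "distributed ?M (gamma_space 2) (eliminate 3 1) (\<lambda>\<gamma>. ennreal (max_ent_prior 2 \<gamma>))"
    by (auto simp: elimination_invariant_def dest!: spec[of _ 3] bspec[of _ _ 1])
  \<comment> \<open>\<open>skip_team 1\<close> sends the new teams 1 and 2 to the old teams 2 and
    3.\<close>
  have elim: "log_odds 2 (eliminate 3 1 \<gamma>) 1 2 = log_odds 3 \<gamma> 2 3" for \<gamma>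
    by (simp add: eliminate_def log_odds_gamma_of skip_team_def log_odds_def[of 3] flip: numeral_2_eq_2)
  have "density lborel (\<lambda>x. ennreal (density23_S3 x)) = distr ?M lborel (\<lambda>\<gamma>. log_odds 3 \<gamma> 2 3)"
    using distributed_distr_eq_density[OF distributed_log_odds_3] by simp
  \<comment> \<open>The law is computed in two stages, so that the assumption can replace the
    intermediate law by the two-team prior.\<close>
  also have "\<dots> = distr (distr ?M (gamma_space 2) (eliminate 3 1)) lborel (\<lambda>\<gamma>. log_odds 2 \<gamma> 1 2)"
    using log_odds_measurable[of 1 2 2] distributed_measurable[OF D]
    by (subst distr_distr) (auto simp: comp_def elim simp del: One_nat_def)
  also have "\<dots> = distr (prior_measure 2 (max_ent_prior 2)) lborel (\<lambda>\<gamma>. log_odds 2 \<gamma> 1 2)"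
    by (simp only: distributed_distr_eq_density[OF D] prior_measure_def[of 2])
  also have "\<dots> = density lborel (\<lambda>x. ennreal (density23_S2 x))"
    by (rule distributed_distr_eq_density[OF distributed_log_odds_2])
  finally have "AE x in lborel. ennreal (density23_S3 x) = ennreal (density23_S2 x)"
    by (intro sigma_finite_measure.density_unique[OF sigma_finite_lborel]) auto
  then have "AE x in lborel. density23_S3 x = density23_S2 x"
    by eventually_elim (simp add: density23_S2_nonneg density23_S3_nonneg)
  then show False
    using density23_S3_not_AE_eq_density23_S2 by contradiction
qed

lemma proportional_density23_S2:
  "proportional density23_S2 (\<lambda>x. 1 / ((1 + exp (- x)) * (1 + exp x)))"
  unfolding proportional_def
  by (intro exI[of _ "inverse (\<integral>\<gamma>. max_ent_kernel 2 \<gamma> \<partial>gamma_space 2)"])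
     (simp add: density23_S2_eq logistic_density_def integral_max_ent_kernel_pos divide_inverse mult_ac)

text \<open>The two \<open>distributed\<close> facts certify that the compared functions really are
  densities of the log-odds-ratio. Their difference is stated as failure of almost-everywhere
  equality because densities are determined only up to null sets.\<close>

theorem mainTheorem9:
  shows "(\<forall>t\<ge>2. proportional (max_ent_prior t) (max_ent_kernel t) \<and>
            team_interchange_invariant t (max_ent_prior t) \<and>
            win_loss_invariant t (max_ent_prior t) \<and>
            normalizable t (max_ent_prior t)) \<and>
         \<not> elimination_invariant max_ent_prior \<and>
         distributed (prior_measure 3 (max_ent_prior 3)) lborel (\<lambda>\<gamma>. log_odds 3 \<gamma> 2 3)
           (\<lambda>x. ennreal (density23_S3 x)) \<and>
         distributed (prior_measure 2 (max_ent_prior 2)) lborel (\<lambda>\<gamma>. log_odds 2 \<gamma> 1 2)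
           (\<lambda>x. ennreal (density23_S2 x)) \<and>
         \<not> (AE x in lborel. density23_S3 x = density23_S2 x) \<and>
         proportional density23_S2 (\<lambda>x. 1 / ((1 + exp (- x)) * (1 + exp x)))"
  using proportional_max_ent_prior team_interchange_invariant_max_ent_prior
    win_loss_invariant_max_ent_prior normalizable_max_ent_prior
    not_elimination_invariant_max_ent_prior distributed_log_odds_3 distributed_log_odds_2
    density23_S3_not_AE_eq_density23_S2 proportional_density23_S2
  by blast

end
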